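(* For $\beta,\mu\in\mathbb{R}$ let $\phi_{\beta,\mu}(t):=\dfrac{e^{\beta t}}{(1+e^{t})^{\mu}}$, and for $\gamma,\nu\in\mathbb{R}$ let $\psi_{\gamma,\nu}(t):=\gamma(1-e^{-t})^{\gamma-1}e^{-\nu t}\chi_{(0,\infty)}(t)$, $t\in\mathbb{R}$. Fix $\beta,\gamma,\mu,\nu>0$. Then $$(\phi_{\beta,\mu}*\psi_{\gamma,\nu})(t)=\gamma B(\gamma,\beta+\nu)\,\phi_{\beta,\mu}(t)\;{}_2F_1\!\left(\mu,\gamma;\beta+\gamma+\nu;\frac{e^t}{e^t+1}\right),\qquad t\in\mathbb{R}.$$ In particular: (i) for $\beta,\gamma>0$ and $\lambda>\beta$, $\ \phi_{\beta,\lambda+\gamma}*\psi_{\gamma,\lambda-\beta}=\gamma B(\gamma,\lambda)\,\phi_{\beta,\lambda}$; (ii) for $0<\beta<1$, $\mu>0$ and $t\in\mathbb{R}$, $$(\phi_{\beta,\mu}*\psi_{1,1-\beta})(t)=\frac{e^{-(1-\beta)t}}{\mu-1}\left(1-\frac{1}{(1+e^t)^{\mu-1}}\right)\quad(\mu\ne1),\qquad (\phi_{\beta,1}*\psi_{1,1-\beta})(t)=e^{-(1-\beta)t}\log(1+e^t).$$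
   Context: $\chi_{(0,\infty)}$ is the characteristic function of $(0,\infty)$; $(f*g)(t)=\int_{-\infty}^\infty f(t-s)g(s)\,ds$; $B$ is the Beta function. The Gaussian hypergeometric function ${}_2F_1(a,b;c;z)$ is, for $\Re c>\Re b>0$ and $z\in\mathbb{C}\setminus[1,\infty)$, given by ${}_2F_1(a,b;c;z)=\frac{\Gamma(c)}{\Gamma(c-b)\Gamma(b)}\int_0^1 s^{b-1}(1-s)^{c-b-1}(1-zs)^{-a}ds$ (it agrees with the usual power series for $|z|<1$). *)

theory Defs
  imports "HOL-Analysis.Analysis"
begin

definition fun_conv :: "(real \<Rightarrow> real) \<Rightarrow> (real \<Rightarrow> real) \<Rightarrow> real \<Rightarrow> real" where
  "fun_conv f g t = (LINT s|lborel. f (t - s) * g s)"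

definition phi :: "real \<Rightarrow> real \<Rightarrow> real \<Rightarrow> real" where
  "phi \<beta> \<mu> t = exp (\<beta> * t) / (1 + exp t) powr \<mu>"

(* For t < 0 the base of powr is negative and for t = 0 it is 0, but there the indicator makes
   the product 0, whatever the value of powr. *)
definition psi :: "real \<Rightarrow> real \<Rightarrow> real \<Rightarrow> real" where
  "psi \<gamma> \<nu> t = \<gamma> * (1 - exp (- t)) powr (\<gamma> - 1) * exp (- \<nu> * t) * indicator {0<..} t"

(* Euler's integral for 2F1, meaningful for Re c > Re b > 0 and z outside the real ray
   [1, infinity).  There 1 - z s stays off the nonpositive real axis for 0 < s < 1, so the
   principal branch of powr is the intended (holomorphic in z) one. *)
definition hyp2F1 :: "complex \<Rightarrow> complex \<Rightarrow> complex \<Rightarrow> complex \<Rightarrow> complex" where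
  "hyp2F1 a b c z =
     Gamma c / (Gamma (c - b) * Gamma b) *
     (LINT s:{0<..<1}|lborel.
        complex_of_real s powr (b - 1) * (1 - complex_of_real s) powr (c - b - 1) *
        (1 - z * complex_of_real s) powr (- a))"

end

theory Submission
  imports Defs "HOL-Real_Asymp.Real_Asymp"
begin

text \<open>Put z = e^t/(1+e^t), which lies in (0,1), and substitute x = 1 - e^(-s) in the
  convolution. Since 1 + e^(t-s) = (1+e^t)(1 - zx), the value at t - s of \<open>phi\<close> splits
  off its value at t and leaves (1-x)^\<beta> (1-zx)^(-\<mu>). The factor \<open>psi\<close> gives
  \<gamma> x^(\<gamma>-1) (1-x)^\<nu>, and ds = dx/(1-x). So everything rests on
  \<open>fun_conv_phi_psi\<close>: the convolution is \<gamma> \<open>phi \<beta> \<mu> t\<close>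
  times the integral over (0,1) of \<open>euler_kernel \<gamma> (\<beta> + \<nu>) \<mu> z\<close>.

  This is Euler's integral for 2F1 with parameters \<mu>, \<gamma>; \<beta>+\<gamma>+\<nu>, whose
  Gamma prefactor is 1/B(\<gamma>,\<beta>+\<nu>); \<open>hyp2F1_of_real\<close> links the complex
  definition to the real kernel.

  In the special cases the integral is elementary. If \<mu> is the sum of the two Beta parameters, a
  Moebius map reduces it to a Beta integral (\<open>euler_kernel_integral_sum\<close>). If both Beta
  parameters are 1, only (1-zx)^(-\<mu>) remains, and an antiderivative finishes, a power or, for
  \<mu> = 1, a logarithm (\<open>euler_kernel_one_one_integral\<close>).\<close>

section \<open>The Euler integrand: Beta case and integrability\<close>

definition euler_kernel :: "real \<Rightarrow> real \<Rightarrow> real \<Rightarrow> real \<Rightarrow> real \<Rightarrow> real" where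
  "euler_kernel a b \<mu> z x = x powr (a - 1) * (1 - x) powr (b - 1) * (1 - z * x) powr (- \<mu>)"

lemma one_minus_mult_pos:
  fixes z x :: real
  assumes "0 \<le> z" "z < 1" "x \<le> 1"
  shows "0 < 1 - z * x"
proof -
  have "z * x \<le> z * 1"
    using assms by (intro mult_left_mono) auto
  with assms show ?thesis by simp
qed

lemma euler_kernel_zero:
  "euler_kernel a b \<mu> 0 x = x powr (a - 1) * (1 - x) powr (b - 1)"
  by (simp add: euler_kernel_def)

lemma euler_kernel_zero_integral:
  fixes a b :: real
  assumes "0 < a" "0 < b"
  shows "set_integrable lborel {0<..<1} (euler_kernel a b \<mu> 0)"
    and "(LINT x:{0<..<1}|lborel. euler_kernel a b \<mu> 0 x) = Beta a b"
proof -
  have I: "(euler_kernel a b \<mu> 0 has_integral Beta a b) {0<..<1}"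
    using has_integral_Beta_real[OF assms]
    by (simp add: has_integral_Icc_iff_Ioo euler_kernel_zero[abs_def])
  then have "euler_kernel a b \<mu> 0 absolutely_integrable_on {0<..<1}"
    by (intro nonnegative_absolutely_integrable_1) (auto simp: euler_kernel_zero)
  \<comment> \<open>Absolute integrability refers to the completed measure; the kernel is Borel, so
    it descends to \<open>lborel\<close>.\<close>
  then show int: "set_integrable lborel {0<..<1} (euler_kernel a b \<mu> 0)"
    unfolding set_integrable_def
    by (subst (asm) integrable_completion) (auto simp: euler_kernel_def[abs_def])
  show "(LINT x:{0<..<1}|lborel. euler_kernel a b \<mu> 0 x) = Beta a b"
    using set_borel_integral_eq_integral(2)[OF int] I by (simp add: integral_unique)
qed

text \<open>Domination by a multiple of the Beta integrand: on (0,1) the last factor is at most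
  (1-z)^(-\<mu>), as zx \<le> z and \<mu> \<ge> 0.\<close>

lemma euler_kernel_integrable:
  fixes a b \<mu> z :: real
  assumes "0 < a" "0 < b" "0 \<le> \<mu>" "0 \<le> z" "z < 1"
  shows "set_integrable lborel {0<..<1} (euler_kernel a b \<mu> z)"
proof (rule set_integrable_bound)
  show "set_integrable lborel {0<..<1} (\<lambda>x. (1 - z) powr (- \<mu>) * euler_kernel a b \<mu> 0 x)"
    using assms by (intro set_integrable_mult_right euler_kernel_zero_integral)
  show "set_borel_measurable lborel {0<..<1} (euler_kernel a b \<mu> z)"
    unfolding set_borel_measurable_def euler_kernel_def by measurable
  have "norm (euler_kernel a b \<mu> z x) \<le> norm ((1 - z) powr (- \<mu>) * euler_kernel a b \<mu> 0 x)"
    if "0 < x" "x < 1" for x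
  proof -
    have "z * x \<le> z * 1"
      using assms that by (intro mult_left_mono) auto
    then have "(1 - z * x) powr (- \<mu>) \<le> (1 - z) powr (- \<mu>)"
      using assms by (intro powr_mono2') auto
    then show ?thesis
      by (auto simp: euler_kernel_def abs_mult mult.commute intro!: mult_right_mono)
  qed
  then show "AE x in lborel. x \<in> {0<..<1} \<longrightarrow>
      norm (euler_kernel a b \<mu> z x) \<le> norm ((1 - z) powr (- \<mu>) * euler_kernel a b \<mu> 0 x)"
    by auto
qed

section \<open>Euler's integral at real arguments\<close>

text \<open>For s in (0,1) and z in [0,1) the three bases s, 1-s and 1-zs are positive reals, where
  the principal complex power agrees with the real one.\<close>

lemma hyp2F1_of_real:
  fixes a b c z :: real
  assumes "0 \<le> z" "z < 1"
  shows "hyp2F1 (complex_of_real a) (complex_of_real b) (complex_of_real c) (complex_of_real z) =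
    complex_of_real (Gamma c / (Gamma (c - b) * Gamma b) *
      (LINT x:{0<..<1}|lborel. euler_kernel b (c - b) a z x))"
proof -
  have "(LINT s:{0<..<1}|lborel.
        complex_of_real s powr (complex_of_real b - 1) *
        (1 - complex_of_real s) powr (complex_of_real c - complex_of_real b - 1) *
        (1 - complex_of_real z * complex_of_real s) powr (- complex_of_real a)) =
      (LINT x:{0<..<1}|lborel. complex_of_real (euler_kernel b (c - b) a z x))"
  proof (rule set_lebesgue_integral_cong)
    show "\<forall>s. s \<in> {0<..<1} \<longrightarrow> complex_of_real s powr (complex_of_real b - 1) *
        (1 - complex_of_real s) powr (complex_of_real c - complex_of_real b - 1) *
        (1 - complex_of_real z * complex_of_real s) powr (- complex_of_real a) =
        complex_of_real (euler_kernel b (c - b) a z s)"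
    proof (intro allI impI)
      fix s :: real
      assume "s \<in> {0<..<1}"
      then have "0 < s" "s < 1" by auto
      moreover have "0 < 1 - z * s"
        using one_minus_mult_pos assms \<open>s < 1\<close> by simp
      ultimately show "complex_of_real s powr (complex_of_real b - 1) *
        (1 - complex_of_real s) powr (complex_of_real c - complex_of_real b - 1) *
        (1 - complex_of_real z * complex_of_real s) powr (- complex_of_real a) =
        complex_of_real (euler_kernel b (c - b) a z s)"
        by (simp add: euler_kernel_def flip: powr_of_real)
    qed
  qed simp
  also have "\<dots> = complex_of_real (LINT x:{0<..<1}|lborel. euler_kernel b (c - b) a z x)"
    by (rule set_integral_complex_of_real)
  finally show ?thesis
    by (simp add: hyp2F1_def Gamma_complex_of_real flip: of_real_diff)
qed

section \<open>The convolution as an Euler integral\<close>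

text \<open>Substitute \<open>x = 1 - exp (- s)\<close> in the convolution integral.\<close>
lemma fun_conv_phi_psi:
  fixes \<beta> \<gamma> \<mu> \<nu> t :: real
  assumes "0 < \<gamma>" "0 < \<beta> + \<nu>" "0 \<le> \<mu>"
  shows "fun_conv (phi \<beta> \<mu>) (psi \<gamma> \<nu>) t = \<gamma> * phi \<beta> \<mu> t *
    (LINT x:{0<..<1}|lborel. euler_kernel \<gamma> (\<beta> + \<nu>) \<mu> (exp t / (exp t + 1)) x)"
proof -
  define z where "z = exp t / (exp t + 1)"
  have z: "0 \<le> z" "z < 1"
    by (auto simp: z_def add_pos_pos)
  \<comment> \<open>The integrand without the indicator, so that it is continuous at every point of
    (0,\<infinity>).\<close>
  define f where
    "f s = phi \<beta> \<mu> (t - s) * (\<gamma> * (1 - exp (- s)) powr (\<gamma> - 1) * exp (- \<nu> * s))" for s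
  \<comment> \<open>The inverse of s \<mapsto> 1 - e^(-s), mapping (0,1) onto
    (0,\<infinity>).\<close>
  define g where "g x = - ln (1 - x)" for x :: real
  define g' where "g' x = 1 / (1 - x)" for x :: real
  have fg: "f (g x) * g' x = \<gamma> * phi \<beta> \<mu> t * euler_kernel \<gamma> (\<beta> + \<nu>) \<mu> z x"
    if "0 < x" "x < 1" for x
  proof -
    \<comment> \<open>As e^(-g x) = 1 - x, the left side is (1+e^t) - x e^t, and factoring out 1+e^t
      produces z.\<close>
    have e1: "1 + exp (t - g x) = (1 + exp t) * (1 - z * x)"
      using that add_pos_pos[of "exp t" 1] by (simp add: g_def z_def exp_add field_simps)
    have p1: "(1 + exp (t - g x)) powr \<mu> = (1 + exp t) powr \<mu> * (1 - z * x) powr \<mu>"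
      unfolding e1 by (rule powr_mult)
    have p2: "exp (\<beta> * (t - g x)) = exp (\<beta> * t) * (1 - x) powr \<beta>"
      using that by (simp add: g_def powr_def algebra_simps flip: exp_add)
    have p3: "exp (- \<nu> * g x) = (1 - x) powr \<nu>"
      using that by (simp add: g_def powr_def)
    have p4: "1 - exp (- g x) = x"
      using that by (simp add: g_def)
    have p5: "(1 - x) powr (\<beta> + \<nu> - 1) = (1 - x) powr \<beta> * (1 - x) powr \<nu> * g' x"
      using that by (simp add: powr_diff powr_add g'_def)
    show ?thesis
      unfolding f_def phi_def euler_kernel_def p1 p2 p3 p4 p5 by (simp add: powr_minus_divide)
  qed
  have "fun_conv (phi \<beta> \<mu>) (psi \<gamma> \<nu>) t = (LINT s:{0<..}|lborel. f s)"
    unfolding fun_conv_def set_lebesgue_integral_def psi_def f_def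
    by (intro Bochner_Integration.integral_cong) (auto simp: indicator_def)
  also have "\<dots> = (LBINT s=ereal 0..\<infinity>. f s)"
    by (simp add: interval_integral_to_infinity_eq)
  also have "\<dots> = (LBINT x=ereal 0..ereal 1. f (g x) * g' x)"
  \<comment> \<open>For nonnegative integrands it suffices that the transformed side is integrable,
    which the domination bound supplies.\<close>
  proof (rule interval_integral_substitution_nonneg(2))
    fix x :: real
    assume x: "ereal 0 < ereal x" "ereal x < ereal 1"
    then have gx: "0 < g x" by (simp add: g_def)
    show "DERIV g x :> g' x"
      unfolding g_def g'_def using x by (auto intro!: derivative_eq_intros simp: field_simps)
    show "isCont f (g x)"
      unfolding f_def phi_def using gx
      by (intro continuous_intros) (auto simp: add_pos_pos add_nonneg_eq_0_iff)
    show "isCont g' x"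
      unfolding g'_def using x by (intro continuous_intros) auto
    show "0 \<le> f (g x)"
      using assms by (simp add: f_def phi_def)
  next
    fix x :: real
    assume "ereal 0 \<le> ereal x" "ereal x \<le> ereal 1"
    \<comment> \<open>The closed interval includes x = 1, where division by zero gives
      \<open>g' 1 = 0\<close>.\<close>
    then show "0 \<le> g' x" by (simp add: g'_def)
  next
    have "(g \<longlongrightarrow> g 0) (at_right 0)"
      unfolding g_def by (intro tendsto_intros) auto
    then show "((ereal \<circ> g \<circ> real_of_ereal) \<longlongrightarrow> ereal 0) (at_right (ereal 0))"
      by (simp add: ereal_tendsto_simps g_def)
    have "filterlim g at_top (at_left 1)"
      unfolding g_def by real_asymp
    then show "((ereal \<circ> g \<circ> real_of_ereal) \<longlongrightarrow> \<infinity>) (at_left (ereal 1))"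
      by (simp add: ereal_tendsto_simps)
  next
    have "set_integrable lborel {0<..<1} (\<lambda>x. \<gamma> * phi \<beta> \<mu> t * euler_kernel \<gamma> (\<beta> + \<nu>) \<mu> z x)"
      using assms z by (intro set_integrable_mult_right euler_kernel_integrable)
    then show "set_integrable lborel (einterval (ereal 0) (ereal 1)) (\<lambda>x. f (g x) * g' x)"
      by (subst set_integrable_cong[OF refl refl fg]) (auto simp: einterval_iff)
  qed simp
  also have "\<dots> = (LINT x:{0<..<1}|lborel. f (g x) * g' x)"
    by (simp add: interval_integral_Ioo)
  also have "\<dots> = (LINT x:{0<..<1}|lborel. \<gamma> * phi \<beta> \<mu> t * euler_kernel \<gamma> (\<beta> + \<nu>) \<mu> z x)"
    using fg by (intro set_lebesgue_integral_cong) auto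
  finally show ?thesis
    by (simp add: z_def)
qed

section \<open>Closed forms of the Euler integral\<close>

text \<open>The Moebius map \<open>x \<mapsto> x (1 - z) / (1 - z x)\<close> of the unit interval carries this integrand
  to that of the Beta integral.\<close>
lemma euler_kernel_integral_sum:
  fixes a b z :: real
  assumes "0 < a" "0 < b" "0 \<le> z" "z < 1"
  shows "(LINT x:{0<..<1}|lborel. euler_kernel a b (a + b) z x) = (1 - z) powr (- a) * Beta a b"
proof -
  define f where "f = euler_kernel a b 0 0"
  define g where "g x = x * (1 - z) / (1 - z * x)" for x
  define g' where "g' x = (1 - z) / (1 - z * x)\<^sup>2" for x
  have pos: "0 < 1 - z * x" if "x \<le> 1" for x
    using one_minus_mult_pos assms that by simp
  have g1: "1 - g x = (1 - x) / (1 - z * x)" if "x \<le> 1" for x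
    using pos[OF that] by (simp add: g_def field_simps)
  have fg: "f (g x) * g' x = (1 - z) powr a * euler_kernel a b (a + b) z x"
    if x: "0 < x" "x < 1" for x
  proof -
    define w where "w = 1 - z * x"
    have w: "0 < w" using pos x by (simp add: w_def)
    have "f (g x) * g' x =
      (x * (1 - z) / w) powr (a - 1) * ((1 - x) / w) powr (b - 1) * ((1 - z) / w\<^sup>2)"
      using g1[of x] x by (simp add: f_def euler_kernel_zero g_def g'_def w_def)
    also have "\<dots> = x powr (a - 1) * (1 - x) powr (b - 1) * ((1 - z) powr (a - 1) * (1 - z)) /
        (w powr (a - 1) * w powr (b - 1) * w\<^sup>2)"
      using x w assms by (simp add: powr_divide powr_mult)
    also have "(1 - z) powr (a - 1) * (1 - z) = (1 - z) powr a"
      using assms by (simp add: powr_diff)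
    \<comment> \<open>The exponents (a-1) + (b-1) + 2 add up to a+b: this is what singles out \<mu>
      = a+b.\<close>
    also have "w powr (a - 1) * w powr (b - 1) * w\<^sup>2 = w powr (a + b)"
      using w by (simp add: powr_diff powr_add power2_eq_square)
    finally show ?thesis
      by (simp add: euler_kernel_def w_def powr_minus_divide del: minus_add_distrib)
  qed
  have "Beta a b = (LBINT x=ereal 0..ereal 1. f x)"
    using euler_kernel_zero_integral(2)[OF assms(1,2)] by (simp add: interval_integral_Ioo f_def)
  also have "\<dots> = (LBINT x=ereal 0..ereal 1. f (g x) * g' x)"
  proof (rule interval_integral_substitution_nonneg(2))
    fix x :: real
    assume "ereal 0 < ereal x" "ereal x < ereal 1"
    then have x: "0 < x" "x < 1" by auto
    have gx: "0 < g x" using x assms pos[of x] by (simp add: g_def)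
    have gx': "0 < 1 - g x" using x pos[of x] by (simp add: g1)
    show "DERIV g x :> g' x"
      unfolding g_def g'_def using pos[of x] x
      by (auto intro!: derivative_eq_intros simp: field_simps power2_eq_square)
    show "isCont f (g x)"
      unfolding f_def euler_kernel_zero[abs_def] using gx gx' by (intro continuous_intros) auto
    show "isCont g' x"
      unfolding g'_def using pos[of x] x by (intro continuous_intros) auto
    show "0 \<le> f (g x)"
      by (simp add: f_def euler_kernel_zero)
  next
    fix x :: real
    show "0 \<le> g' x" using assms by (simp add: g'_def)
  next
    have "(g \<longlongrightarrow> g 0) (at_right 0)"
      unfolding g_def by (intro tendsto_intros) auto
    then show "((ereal \<circ> g \<circ> real_of_ereal) \<longlongrightarrow> ereal 0) (at_right (ereal 0))"
      by (simp add: ereal_tendsto_simps g_def)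
    have "(g \<longlongrightarrow> g 1) (at_left 1)"
      unfolding g_def using assms by (intro tendsto_intros) auto
    then show "((ereal \<circ> g \<circ> real_of_ereal) \<longlongrightarrow> ereal 1) (at_left (ereal 1))"
      using assms by (simp add: ereal_tendsto_simps g_def)
  next
    have "set_integrable lborel {0<..<1} (\<lambda>x. (1 - z) powr a * euler_kernel a b (a + b) z x)"
      using assms by (intro set_integrable_mult_right euler_kernel_integrable) auto
    then show "set_integrable lborel (einterval (ereal 0) (ereal 1)) (\<lambda>x. f (g x) * g' x)"
      by (subst set_integrable_cong[OF refl refl fg]) (auto simp: einterval_iff)
  qed simp
  also have "\<dots> = (LINT x:{0<..<1}|lborel. f (g x) * g' x)"
    by (simp add: interval_integral_Ioo)
  also have "\<dots> = (LINT x:{0<..<1}|lborel. (1 - z) powr a * euler_kernel a b (a + b) z x)"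
    using fg by (intro set_lebesgue_integral_cong) auto
  finally show ?thesis
    using assms by (simp add: powr_minus_divide)
qed

text \<open>Both Beta factors are 1 on (0,1), so the fundamental theorem of calculus applies; 1-zx
  stays positive up to x = 1. The antiderivative is a parameter so that one lemma serves both \<mu>
  = 1 and \<mu> \<noteq> 1.\<close>

lemma euler_kernel_one_one_integral:
  fixes z \<mu> :: real and F :: "real \<Rightarrow> real"
  assumes "0 \<le> z" "z < 1"
    and F: "\<And>x. 0 \<le> x \<Longrightarrow> x \<le> 1 \<Longrightarrow> DERIV F x :> (1 - z * x) powr (- \<mu>)"
  shows "(LINT x:{0<..<1}|lborel. euler_kernel 1 1 \<mu> z x) = F 1 - F 0"
proof -
  have pos: "0 < 1 - z * x" if "x \<le> 1" for x
    using one_minus_mult_pos assms that by simp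
  have "(LINT x:{0<..<1}|lborel. euler_kernel 1 1 \<mu> z x) =
      (LINT x:{0<..<1}|lborel. (1 - z * x) powr (- \<mu>))"
    by (intro set_lebesgue_integral_cong) (auto simp: euler_kernel_def)
  also have "\<dots> = (LBINT x=ereal 0..ereal 1. (1 - z * x) powr (- \<mu>))"
    by (simp add: interval_integral_Ioo)
  also have "\<dots> = F 1 - F 0"
  proof (rule interval_integral_FTC_finite)
    show "continuous_on {min 0 1..max 0 1} (\<lambda>x. (1 - z * x) powr (- \<mu>))"
      using pos by (intro continuous_intros) (auto simp: less_le)
    show "(F has_vector_derivative (1 - z * x) powr (- \<mu>)) (at x within {min 0 1..max 0 1})"
      if "min 0 1 \<le> x" "x \<le> max 0 1" for x
      using F[of x] that
      by (auto simp: has_real_derivative_iff_has_vector_derivative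
          intro: has_vector_derivative_at_within)
  qed
  finally show ?thesis .
qed

section \<open>Evaluation of the convolution\<close>

text \<open>Since 1-z = 1/(1+e^t), the power contributes (1+e^t)^\<gamma>, which cancels \<gamma>
  from the exponent in \<open>phi\<close>.\<close>

lemma phi_one_minus:
  "phi \<beta> (lam + \<gamma>) t * (1 - exp t / (exp t + 1)) powr (- \<gamma>) = phi \<beta> lam t"
proof -
  have "1 - exp t / (exp t + 1) = 1 / (1 + exp t)"
    using add_pos_pos[of "exp t" 1] by (simp add: field_simps)
  then show ?thesis
    using add_pos_pos[of 1 "exp t"] by (simp add: phi_def powr_add powr_minus_divide powr_divide)
qed

lemma fun_conv_phi_psi_hyp2F1:
  fixes \<beta> \<gamma> \<mu> \<nu> t :: real
  assumes "0 < \<beta>" "0 < \<gamma>" "0 < \<mu>" "0 < \<nu>"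
  shows "complex_of_real (fun_conv (phi \<beta> \<mu>) (psi \<gamma> \<nu>) t) =
    complex_of_real (\<gamma> * Beta \<gamma> (\<beta> + \<nu>) * phi \<beta> \<mu> t) *
    hyp2F1 (complex_of_real \<mu>) (complex_of_real \<gamma>) (complex_of_real (\<beta> + \<gamma> + \<nu>))
      (complex_of_real (exp t / (exp t + 1)))"
proof -
  have z: "0 \<le> exp t / (exp t + 1)" "exp t / (exp t + 1) < 1"
    by (auto simp: add_pos_pos)
  have Gamma_pos: "Gamma (\<beta> + \<gamma> + \<nu>) > 0" "Gamma (\<beta> + \<nu>) > 0" "Gamma \<gamma> > 0"
    using assms by (auto intro!: Gamma_real_pos)
  \<comment> \<open>Euler's prefactor for b = \<gamma>, c-b = \<beta>+\<nu> is the reciprocal of the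
    Beta value.\<close>
  have "Beta \<gamma> (\<beta> + \<nu>) * (Gamma (\<beta> + \<gamma> + \<nu>) / (Gamma (\<beta> + \<nu>) * Gamma \<gamma>)) = 1"
    using Gamma_pos by (simp add: Beta_def algebra_simps)
  moreover have "\<beta> + \<gamma> + \<nu> - \<gamma> = \<beta> + \<nu>"
    by simp
  ultimately show ?thesis
    unfolding hyp2F1_of_real[OF z] of_real_mult[symmetric] of_real_eq_iff
    using assms by (subst fun_conv_phi_psi) (auto simp: algebra_simps)
qed

text \<open>Here \<nu> = lam - \<beta> makes the Beta parameters \<gamma> and lam, and \<mu> = lam +
  \<gamma> is their sum, so the Moebius evaluation applies.\<close>

lemma fun_conv_phi_psi_sum:
  fixes \<beta> \<gamma> lam t :: real
  assumes "0 < \<gamma>" "0 < lam"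
  shows "fun_conv (phi \<beta> (lam + \<gamma>)) (psi \<gamma> (lam - \<beta>)) t = \<gamma> * Beta \<gamma> lam * phi \<beta> lam t"
proof -
  have z: "0 \<le> exp t / (exp t + 1)" "exp t / (exp t + 1) < 1"
    by (auto simp: add_pos_pos)
  show ?thesis
    using assms fun_conv_phi_psi[of \<gamma> \<beta> "lam - \<beta>" "lam + \<gamma>" t]
      euler_kernel_integral_sum[OF assms z] phi_one_minus[of \<beta> lam \<gamma> t]
    by (simp add: ac_simps)
qed

lemma fun_conv_phi_psi_one:
  fixes \<beta> \<mu> t :: real
  assumes "0 \<le> \<mu>" "\<mu> \<noteq> 1"
  shows "fun_conv (phi \<beta> \<mu>) (psi 1 (1 - \<beta>)) t =
    exp (- (1 - \<beta>) * t) / (\<mu> - 1) * (1 - 1 / (1 + exp t) powr (\<mu> - 1))"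
proof -
  define z where "z = exp t / (exp t + 1)"
  have z: "0 < z" "z < 1"
    by (auto simp: z_def add_pos_pos)
  \<comment> \<open>Differentiating the power brings down -z(1-\<mu>) = z(\<mu>-1), hence the
    divisor.\<close>
  define F where "F x = (1 - z * x) powr (1 - \<mu>) / (z * (\<mu> - 1))" for x
  have "(LINT x:{0<..<1}|lborel. euler_kernel 1 1 \<mu> z x) = F 1 - F 0"
  proof (rule euler_kernel_one_one_integral)
    fix x :: real
    assume "0 \<le> x" "x \<le> 1"
    then have "0 < 1 - z * x" using one_minus_mult_pos z by simp
    then show "DERIV F x :> (1 - z * x) powr (- \<mu>)"
      unfolding F_def using z assms
      by (auto intro!: derivative_eq_intros simp: divide_simps) (simp add: algebra_simps)
  qed (use z in auto)
  moreover have "1 - z = 1 / (1 + exp t)"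
    using add_pos_pos[of "exp t" 1] by (simp add: z_def field_simps)
  ultimately have "fun_conv (phi \<beta> \<mu>) (psi 1 (1 - \<beta>)) t =
      phi \<beta> \<mu> t * (((1 / (1 + exp t)) powr (1 - \<mu>) - 1) / (z * (\<mu> - 1)))"
    using assms by (simp add: fun_conv_phi_psi F_def diff_divide_distrib flip: z_def)
  also have "(1 / (1 + exp t)) powr (1 - \<mu>) = (1 + exp t) powr \<mu> / (1 + exp t)"
    using add_pos_pos[of 1 "exp t"] by (simp add: powr_divide powr_diff)
  \<comment> \<open>Dividing by z multiplies by (1+e^t)/e^t; the 1+e^t is absorbed into the bracket
    and 1/e^t stays in front.\<close>
  also have "phi \<beta> \<mu> t * (((1 + exp t) powr \<mu> / (1 + exp t) - 1) / (z * (\<mu> - 1))) =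
      exp (\<beta> * t) / exp t / (\<mu> - 1) * (1 - (1 + exp t) / (1 + exp t) powr \<mu>)"
  proof -
    have "0 < 1 + exp t" by (simp add: add_pos_pos)
    moreover from this have "0 < (1 + exp t) powr \<mu>" by simp
    ultimately show ?thesis
      using assms by (simp add: phi_def z_def divide_simps)
  qed
  also have "exp (\<beta> * t) / exp t = exp (- (1 - \<beta>) * t)"
    by (simp add: algebra_simps flip: exp_diff)
  also have "(1 + exp t) / (1 + exp t) powr \<mu> = 1 / (1 + exp t) powr (\<mu> - 1)"
    using add_pos_pos[of 1 "exp t"] by (simp add: powr_diff)
  finally show ?thesis .
qed

lemma fun_conv_phi_one_psi_one:
  "fun_conv (phi \<beta> 1) (psi 1 (1 - \<beta>)) t = exp (- (1 - \<beta>) * t) * ln (1 + exp t)"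
proof -
  define z where "z = exp t / (exp t + 1)"
  have z: "0 < z" "z < 1"
    by (auto simp: z_def add_pos_pos)
  have pos: "0 < 1 + exp t" by (simp add: add_pos_pos)
  \<comment> \<open>Here F 0 = 0 and F 1 = log(1+e^t)/z, because 1-z = 1/(1+e^t).\<close>
  define F where "F x = - ln (1 - z * x) / z" for x
  have "(LINT x:{0<..<1}|lborel. euler_kernel 1 1 1 z x) = F 1 - F 0"
  proof (rule euler_kernel_one_one_integral)
    fix x :: real
    assume "0 \<le> x" "x \<le> 1"
    then have "0 < 1 - z * x" using one_minus_mult_pos z by simp
    then show "DERIV F x :> (1 - z * x) powr (- 1)"
      unfolding F_def using z
      by (auto intro!: derivative_eq_intros simp: powr_minus_divide field_simps)
  qed (use z in auto)
  moreover have "1 - z = 1 / (1 + exp t)"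
    using pos by (simp add: z_def field_simps)
  ultimately have "fun_conv (phi \<beta> 1) (psi 1 (1 - \<beta>)) t = phi \<beta> 1 t * (ln (1 + exp t) / z)"
    using pos by (simp add: fun_conv_phi_psi F_def ln_div flip: z_def)
  \<comment> \<open>The denominator 1+e^t of \<open>phi \<beta> 1 t\<close> cancels against that of
    z.\<close>
  also have "\<dots> = exp (\<beta> * t) / exp t * ln (1 + exp t)"
    using pos by (simp add: phi_def z_def add.commute divide_simps)
  also have "exp (\<beta> * t) / exp t = exp (- (1 - \<beta>) * t)"
    by (simp add: algebra_simps flip: exp_diff)
  finally show ?thesis .
qed

theorem proposition4:
  shows "(\<forall>\<beta> \<gamma> \<mu> \<nu> :: real. \<beta> > 0 \<longrightarrow> \<gamma> > 0 \<longrightarrow> \<mu> > 0 \<longrightarrow> \<nu> > 0 \<longrightarrow>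
            (\<forall>t :: real.
               complex_of_real (fun_conv (phi \<beta> \<mu>) (psi \<gamma> \<nu>) t) =
               complex_of_real (\<gamma> * Beta \<gamma> (\<beta> + \<nu>) * phi \<beta> \<mu> t) *
               hyp2F1 (complex_of_real \<mu>) (complex_of_real \<gamma>) (complex_of_real (\<beta> + \<gamma> + \<nu>))
                 (complex_of_real (exp t / (exp t + 1)))))
       \<and> (\<forall>\<beta> \<gamma> lam :: real. \<beta> > 0 \<longrightarrow> \<gamma> > 0 \<longrightarrow> lam > \<beta> \<longrightarrow>
            fun_conv (phi \<beta> (lam + \<gamma>)) (psi \<gamma> (lam - \<beta>)) = (\<lambda>t. \<gamma> * Beta \<gamma> lam * phi \<beta> lam t))
       \<and> (\<forall>\<beta> :: real. 0 < \<beta> \<longrightarrow> \<beta> < 1 \<longrightarrow>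
            (\<forall>\<mu> t :: real. \<mu> > 0 \<longrightarrow> \<mu> \<noteq> 1 \<longrightarrow>
               fun_conv (phi \<beta> \<mu>) (psi 1 (1 - \<beta>)) t =
               exp (- (1 - \<beta>) * t) / (\<mu> - 1) * (1 - 1 / (1 + exp t) powr (\<mu> - 1)))
          \<and> (\<forall>t :: real.
               fun_conv (phi \<beta> 1) (psi 1 (1 - \<beta>)) t = exp (- (1 - \<beta>) * t) * ln (1 + exp t)))"
  by (intro conjI allI impI ext)
     (simp_all add: fun_conv_phi_psi_hyp2F1 fun_conv_phi_psi_sum fun_conv_phi_psi_one
       fun_conv_phi_one_psi_one)

end
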